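(* Let $A \in \mathbb{R}^{n\times n}$ be an arbitrary (possibly singular) matrix, let $C \in \mathbb{R}^{n\times n}$ be symmetric positive definite, and let $b \in \mathbb{R}^n$ be arbitrary ($b$ need not lie in the range of $A$). Apply GMRES (in exact arithmetic) to $A C A^{\mathsf T} z = b$ with an arbitrary initial vector $z_0 \in \mathbb{R}^n$. Then GMRES determines, without breakdown, a least squares solution $z$ of $\min_{z \in \mathbb{R}^n}\|b - A C A^{\mathsf T} z\|_2$, and $x = C A^{\mathsf T} z$ is a least squares solution of $Ax = b$, i.e. $\|b - Ax\|_2 = \min_{y\in\mathbb{R}^n}\|b - Ay\|_2$.
   Context: GMRES applied to $Mz=b$ with $M\in\mathbb{R}^{n\times n}$ and initial vector $z_0$: put $r_0 = b - Mz_0$ and $\mathcal{K}_k = \mathrm{span}\{r_0, Mr_0, \ldots, M^{k-1}r_0\}$ (with $\mathcal{K}_0=\{0\}$). The $k$th iterate is $z_k = z_0 + w_k$, where $w_k\in\mathcal{K}_k$ minimizes $\|r_0 - Mw\|_2$ over $w\in\mathcal{K}_k$. In the implementation, if $r_0\neq 0$, an orthonormal basis is generated by the Arnoldi process: $v_1 = r_0/\|r_0\|_2$, and for $j=1,2,\ldots$: $h_{i,j} = (v_i, Mv_j)$ for $i=1,\ldots,j$, $\hat v_{j+1} = Mv_j - \sum_{i=1}^j h_{i,j}v_i$, $h_{j+1,j} = \|\hat v_{j+1}\|_2$; if $h_{j+1,j}=0$ the process stops, otherwise $v_{j+1} = \hat v_{j+1}/h_{j+1,j}$. GMRES is said to break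 down at the $k$th iteration when $h_{k+1,k}=0$. "GMRES determines a least squares solution without breakdown" means: there is an iteration index $k\ge 0$ such that the iterate $z_k$ is a minimizer of $\|b - Mz\|_2$ over $z\in\mathbb{R}^n$, and $h_{j+1,j}\neq 0$ for all $1\le j<k$ (no breakdown occurs before a least squares solution is reached). Here $M = ACA^{\mathsf T}$. *)

theory Defs
  imports "HOL-Analysis.Analysis"
begin

definition sym_pos_def :: "real^'n^'n \<Rightarrow> bool" where
  "sym_pos_def C \<longleftrightarrow> transpose C = C \<and> (\<forall>x. x \<noteq> 0 \<longrightarrow> 0 < x \<bullet> (C *v x))"

definition least_squares_solution :: "real^'n^'m \<Rightarrow> real^'m \<Rightarrow> real^'n \<Rightarrow> bool" where
  "least_squares_solution M b z \<longleftrightarrow> is_arg_min (\<lambda>y. norm (b - M *v y)) (\<lambda>_. True) z"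

definition krylov :: "real^'n^'n \<Rightarrow> real^'n \<Rightarrow> nat \<Rightarrow> (real^'n) set" where
  "krylov M r k = span ((\<lambda>i. ((*v) M ^^ i) r) ` {..<k})"

text \<open>
  The minimizer over the Krylov space need not be unique for every \<open>k\<close>, so the iterate is a
  relation. All minimizers for a given \<open>k\<close> have the same residual norm; hence either all of
  them or none of them are least squares solutions.
\<close>

definition gmres_iterate ::
    "real^'n^'n \<Rightarrow> real^'n \<Rightarrow> real^'n \<Rightarrow> nat \<Rightarrow> real^'n \<Rightarrow> bool" where
  "gmres_iterate M b z0 k z \<longleftrightarrow>
     (let r0 = b - M *v z0 in
      \<exists>w. is_arg_min (\<lambda>w. norm (r0 - M *v w)) (\<lambda>w. w \<in> krylov M r0 k) w \<and> z = z0 + w)"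

text \<open>
  The Arnoldi vectors are indexed from \<open>1\<close>; index \<open>0\<close> is unused. The process is made total by
  \<open>inverse 0 = 0\<close>: once it stops (and also if \<open>r = 0\<close>), all later vectors and all later
  subdiagonal entries are \<open>0\<close>, so the first index \<open>j\<close> with \<open>h\<^sub>j\<^sub>+\<^sub>1\<^sub>,\<^sub>j = 0\<close> is the one at which the
  process stops.
\<close>

fun arnoldi_v :: "real^'n^'n \<Rightarrow> real^'n \<Rightarrow> nat \<Rightarrow> real^'n" where
  "arnoldi_v M r 0 = 0"
| "arnoldi_v M r (Suc 0) = r /\<^sub>R norm r"
| "arnoldi_v M r (Suc (Suc j)) =
     (let u = M *v arnoldi_v M r (Suc j);
          vhat = u - (\<Sum>i = 1..Suc j. (arnoldi_v M r i \<bullet> u) *\<^sub>R arnoldi_v M r i)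
      in vhat /\<^sub>R norm vhat)"

definition arnoldi_vhat :: "real^'n^'n \<Rightarrow> real^'n \<Rightarrow> nat \<Rightarrow> real^'n" where
  "arnoldi_vhat M r j = M *v arnoldi_v M r (j - 1) -
     (\<Sum>i = 1..j - 1. (arnoldi_v M r i \<bullet> (M *v arnoldi_v M r (j - 1))) *\<^sub>R arnoldi_v M r i)"

definition arnoldi_h :: "real^'n^'n \<Rightarrow> real^'n \<Rightarrow> nat \<Rightarrow> nat \<Rightarrow> real" where
  "arnoldi_h M r i j =
     (if i \<le> j then arnoldi_v M r i \<bullet> (M *v arnoldi_v M r j)
      else if i = j + 1 then norm (arnoldi_vhat M r (j + 1))
      else 0)"

lemma arnoldi_vhat_step:
  "arnoldi_vhat M r (j + 1) =
     M *v arnoldi_v M r j - (\<Sum>i = 1..j. arnoldi_h M r i j *\<^sub>R arnoldi_v M r i)"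
  by (simp add: arnoldi_vhat_def arnoldi_h_def)

lemma arnoldi_v_step:
  assumes "1 \<le> j"
  shows "arnoldi_v M r (j + 1) = arnoldi_vhat M r (j + 1) /\<^sub>R arnoldi_h M r (j + 1) j"
proof -
  obtain m where "j = Suc m"
    using assms by (cases j) auto
  then show ?thesis
    by (simp add: arnoldi_vhat_def arnoldi_h_def Let_def)
qed

definition gmres_breakdown :: "real^'n^'n \<Rightarrow> real^'n \<Rightarrow> real^'n \<Rightarrow> nat \<Rightarrow> bool" where
  "gmres_breakdown M b z0 k \<longleftrightarrow> arnoldi_h M (b - M *v z0) (k + 1) k = 0"

definition gmres_determines_without_breakdown ::
    "real^'n^'n \<Rightarrow> real^'n \<Rightarrow> real^'n \<Rightarrow> real^'n \<Rightarrow> bool" where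
  "gmres_determines_without_breakdown M b z0 z \<longleftrightarrow>
     (\<exists>k. gmres_iterate M b z0 k z \<and> least_squares_solution M b z \<and>
          (\<forall>j. 1 \<le> j \<and> j < k \<longrightarrow> \<not> gmres_breakdown M b z0 j))"

end

(* A minimizer over a subspace is characterized by the normal equations. Let M be symmetric, r the
   initial residual. If a subspace containing r is invariant under M, a minimizer w over it has its
   residual s = r - M w in it, and the normal equations give (M s) . (M s) = s . M (M s) = 0; so
   M s = 0, which are the normal equations for the whole space. Applied to the union of all Krylov
   spaces, this shows that some iterate is a least squares solution. A breakdown at step j makes the
   j-th Krylov space invariant, so the j-th iterates are then least squares solutions already.
   Finally, for M = A C A^T and s = b - M z = b - A x, the equation M s = 0 implies
   (A^T s) . C (A^T s) = 0, so A^T s = 0, which are the normal equations for A x = b. *)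

theory Submission
  imports Defs
begin

lemma inner_matrix_vector_transpose:
  fixes A :: "real^'n^'m"
  shows "x \<bullet> (A *v y) = (transpose A *v x) \<bullet> y"
  by (simp add: dot_lmul_matrix)

section \<open>Normal equations\<close>

text \<open>For \<open>y\<close> in \<open>S\<close>, the residual at \<open>y\<close> is the
  residual at \<open>w\<close> plus \<open>M *v (w - y)\<close>. These two are orthogonal, so
  Pythagoras gives the bound.\<close>

lemma is_arg_min_residual_if_orthogonal:
  fixes M :: "real^'n^'m"
  assumes "subspace S" "w \<in> S" and orth: "\<And>u. u \<in> S \<Longrightarrow> (r - M *v w) \<bullet> (M *v u) = 0"
  shows "is_arg_min (\<lambda>w. norm (r - M *v w)) (\<lambda>w. w \<in> S) w"
proof -
  have "norm (r - M *v w) \<le> norm (r - M *v y)" if "y \<in> S" for y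
  proof -
    have "w - y \<in> S"
      using assms that by (simp add: subspace_diff)
    then have "orthogonal (r - M *v w) (M *v (w - y))"
      using orth by (simp add: orthogonal_def)
    then have "norm (r - M *v w + M *v (w - y)) ^ 2 = norm (r - M *v w) ^ 2 + norm (M *v (w - y)) ^ 2"
      by (rule norm_add_Pythagorean)
    moreover have "r - M *v w + M *v (w - y) = r - M *v y"
      by (simp add: matrix_vector_mult_diff_distrib)
    ultimately show ?thesis
      by (simp add: norm_le_square power2_norm_eq_inner norm_le)
  qed
  then show ?thesis
    using assms(2) by (auto simp: is_arg_min_linorder)
qed

text \<open>Existence by orthogonal projection: the component of \<open>r\<close> in the image of
  \<open>S\<close> under \<open>M\<close> has the form \<open>M *v w\<close>.\<close>

lemma exists_orthogonal_residual:
  fixes M :: "real^'n^'m"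
  assumes "subspace S"
  obtains w where "w \<in> S" "\<And>u. u \<in> S \<Longrightarrow> (r - M *v w) \<bullet> (M *v u) = 0"
proof -
  have sub: "subspace ((*v) M ` S)"
    using assms by (simp add: linear_subspace_image)
  obtain y z where y: "y \<in> span ((*v) M ` S)"
    and z: "\<And>v. v \<in> span ((*v) M ` S) \<Longrightarrow> orthogonal z v" and r: "r = y + z"
    using orthogonal_subspace_decomp_exists by blast
  obtain w where "w \<in> S" "y = M *v w"
    using y sub by (auto simp: span_eq_iff[THEN iffD2])
  moreover have "(r - M *v w) \<bullet> (M *v u) = 0" if "u \<in> S" for u
    using z[of "M *v u"] that r \<open>y = M *v w\<close> by (simp add: span_base orthogonal_def)
  ultimately show ?thesis
    using that by blast
qed

lemma is_arg_min_residual_iff: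
  fixes M :: "real^'n^'m"
  assumes "subspace S"
  shows "is_arg_min (\<lambda>w. norm (r - M *v w)) (\<lambda>w. w \<in> S) w \<longleftrightarrow>
         w \<in> S \<and> (\<forall>u\<in>S. (r - M *v w) \<bullet> (M *v u) = 0)"
proof
  assume min: "is_arg_min (\<lambda>w. norm (r - M *v w)) (\<lambda>w. w \<in> S) w"
  then have w: "w \<in> S"
    by (simp add: is_arg_min_def)
  \<comment> \<open>\<open>M\<close> may be singular, so \<open>w\<close> and \<open>w0\<close> can
    differ. Pythagoras and minimality of \<open>w\<close> force \<open>M *v w = M *v w0\<close>, and
    \<open>w\<close> inherits the normal equations through this common residual.\<close>
  obtain w0 where w0: "w0 \<in> S" and orth: "\<And>u. u \<in> S \<Longrightarrow> (r - M *v w0) \<bullet> (M *v u) = 0"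
    using exists_orthogonal_residual[OF assms, of r M] by metis
  have "orthogonal (r - M *v w0) (M *v (w0 - w))"
    using orth[of "w0 - w"] w w0 assms by (simp add: orthogonal_def subspace_diff)
  then have "norm (r - M *v w0 + M *v (w0 - w)) ^ 2
      = norm (r - M *v w0) ^ 2 + norm (M *v (w0 - w)) ^ 2"
    by (rule norm_add_Pythagorean)
  moreover have "r - M *v w0 + M *v (w0 - w) = r - M *v w"
    by (simp add: matrix_vector_mult_diff_distrib)
  moreover have "norm (r - M *v w) ^ 2 \<le> norm (r - M *v w0) ^ 2"
    using min w0 by (simp add: is_arg_min_linorder power_mono)
  ultimately have "M *v (w0 - w) = 0"
    by simp
  then have "M *v w = M *v w0"
    by (simp add: matrix_vector_mult_diff_distrib)
  then show "w \<in> S \<and> (\<forall>u\<in>S. (r - M *v w) \<bullet> (M *v u) = 0)"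
    using w orth by simp
qed (use assms is_arg_min_residual_if_orthogonal in blast)

lemma least_squares_solution_iff:
  "least_squares_solution M b z \<longleftrightarrow> transpose M *v (b - M *v z) = 0"
proof -
  have "least_squares_solution M b z \<longleftrightarrow> (\<forall>u. (b - M *v z) \<bullet> (M *v u) = 0)"
    using is_arg_min_residual_iff[of UNIV b M z] by (simp add: least_squares_solution_def)
  also have "\<dots> \<longleftrightarrow> transpose M *v (b - M *v z) = 0"
    \<comment> \<open>A vector orthogonal to every \<open>u\<close> is orthogonal to itself, hence
      zero.\<close>
    unfolding inner_matrix_vector_transpose by (metis inner_eq_zero_iff inner_zero_left)
  finally show ?thesis .
qed

lemma arg_min_invariant_subspace:
  fixes M :: "real^'n^'n"
  assumes "transpose M = M" "subspace S" "r \<in> S"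
    and inv: "\<And>u. u \<in> S \<Longrightarrow> M *v u \<in> S"
    and min: "is_arg_min (\<lambda>w. norm (r - M *v w)) (\<lambda>w. w \<in> S) w"
  shows "M *v (r - M *v w) = 0"
proof -
  define s where "s = r - M *v w"
  have w: "w \<in> S" and orth: "\<forall>u\<in>S. s \<bullet> (M *v u) = 0"
    using min is_arg_min_residual_iff[OF assms(2)] unfolding s_def by blast+
  have "s \<in> S"
    unfolding s_def using assms w by (simp add: subspace_diff)
  \<comment> \<open>The test vector is \<open>u = M *v s\<close>, in \<open>S\<close> by invariance.
    By symmetry the left side is the squared norm of \<open>M *v s\<close>.\<close>
  then have "s \<bullet> (M *v (M *v s)) = 0"
    using orth inv by blast
  then have "M *v s = 0"
    using assms(1) by (simp add: inner_matrix_vector_transpose[of s M])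
  then show ?thesis
    by (simp add: s_def)
qed

section \<open>Krylov spaces and the Arnoldi process\<close>

lemma subspace_krylov: "subspace (krylov M r k)"
  by (simp add: krylov_def)

lemma krylov_mono: "i \<le> j \<Longrightarrow> krylov M r i \<subseteq> krylov M r j"
  unfolding krylov_def by (intro span_mono image_mono) auto

lemma matrix_vector_mult_in_krylov:
  assumes "u \<in> krylov M r k"
  shows "M *v u \<in> krylov M r (Suc k)"
proof -
  have "M *v u \<in> span ((*v) M ` (\<lambda>i. ((*v) M ^^ i) r) ` {..<k})"
    using assms unfolding krylov_def by (simp add: linear_span_image)
  also have "\<dots> \<subseteq> krylov M r (Suc k)"
    unfolding krylov_def by (intro span_mono) (auto intro!: image_eqI[where x = "Suc _"])
  finally show ?thesis .
qed

lemma initial_in_krylov: "1 \<le> k \<Longrightarrow> r \<in> krylov M r k"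
  unfolding krylov_def by (rule span_base) (auto intro!: image_eqI[where x = 0])

lemma krylov_least:
  assumes "subspace S" "r \<in> S" "\<And>u. u \<in> S \<Longrightarrow> M *v u \<in> S"
  shows "krylov M r k \<subseteq> S"
proof -
  have "((*v) M ^^ i) r \<in> S" for i
    using assms by (induction i) auto
  then show ?thesis
    unfolding krylov_def using assms(1) by (intro span_minimal) auto
qed

text \<open>The Krylov spaces are nested, so any two elements lie in a common one. The union serves
  as an invariant space without a stabilization index.\<close>

lemma subspace_Union_krylov: "subspace (\<Union>k. krylov M r k)"
proof (rule subspaceI)
  show "0 \<in> (\<Union>k. krylov M r k)"
    using subspace_0[OF subspace_krylov] by blast
next
  fix x y assume "x \<in> (\<Union>k. krylov M r k)" "y \<in> (\<Union>k. krylov M r k)"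
  then obtain i j where "x \<in> krylov M r i" "y \<in> krylov M r j"
    by blast
  then have "x \<in> krylov M r (max i j)" "y \<in> krylov M r (max i j)"
    using krylov_mono[of i "max i j" M r] krylov_mono[of j "max i j" M r] by auto
  then show "x + y \<in> (\<Union>k. krylov M r k)"
    using subspace_add[OF subspace_krylov] by blast
qed (use subspace_scale[OF subspace_krylov] in blast)

text \<open>Strong induction, since each Arnoldi vector is built from all earlier ones. At index 0
  the zero vector lies in the trivial space.\<close>

lemma arnoldi_v_in_krylov: "arnoldi_v M r j \<in> krylov M r j"
proof (induction j rule: less_induct)
  case (less j)
  show ?case
  proof (cases "j \<le> 1")
    case True
    then consider "j = 0" | "j = Suc 0"
      by linarith
    then show ?thesis
      by cases (simp_all add: subspace_0 subspace_scale subspace_krylov initial_in_krylov)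
  next
    case False
    then obtain i where j: "j = Suc (Suc i)"
      by (metis One_nat_def le_SucI nat_le_linear not0_implies_Suc order_refl)
    have v: "arnoldi_v M r l \<in> krylov M r j" if "l \<in> {1..Suc i}" for l
      using less[of l] krylov_mono[of l j M r] that j by auto
    have "M *v arnoldi_v M r (Suc i) \<in> krylov M r j"
      using less[of "Suc i"] matrix_vector_mult_in_krylov j by blast
    then have "M *v arnoldi_v M r (Suc i) - (\<Sum>l = 1..Suc i.
        (arnoldi_v M r l \<bullet> (M *v arnoldi_v M r (Suc i))) *\<^sub>R arnoldi_v M r l) \<in> krylov M r j"
      using v by (intro subspace_diff subspace_sum subspace_scale subspace_krylov)
    then show ?thesis
      unfolding j arnoldi_v.simps(3) Let_def by (intro subspace_scale subspace_krylov)
  qed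
qed

text \<open>The Arnoldi relation. It survives a breakdown: then \<open>arnoldi_vhat\<close> is zero,
  and so is its multiple on the right.\<close>

lemma matrix_vector_mult_arnoldi_v:
  assumes "1 \<le> j"
  shows "M *v arnoldi_v M r j = arnoldi_h M r (j + 1) j *\<^sub>R arnoldi_v M r (j + 1) +
           (\<Sum>i = 1..j. arnoldi_h M r i j *\<^sub>R arnoldi_v M r i)"
proof -
  have "arnoldi_h M r (j + 1) j *\<^sub>R arnoldi_v M r (j + 1) = arnoldi_vhat M r (j + 1)"
    using arnoldi_v_step[OF assms, of M r]
    by (cases "arnoldi_vhat M r (j + 1) = 0") (simp_all add: arnoldi_h_def)
  then show ?thesis
    unfolding arnoldi_vhat_step by (simp only: diff_add_cancel)
qed

text \<open>By the Arnoldi relation, \<open>M\<close> sends the \<open>i\<close>-th vector into the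
  span of the first \<open>i + 1\<close>; for \<open>i = j\<close> the last coefficient vanishes. So
  the span \<open>V\<close> of the first \<open>j\<close> vectors is invariant. It contains
  \<open>r\<close>, hence the Krylov space, and is contained in it.\<close>

lemma krylov_invariant_if_breakdown:
  assumes "1 \<le> j" and h: "arnoldi_h M r (j + 1) j = 0" and u: "u \<in> krylov M r j"
  shows "M *v u \<in> krylov M r j"
proof -
  define V where "V = span (arnoldi_v M r ` {1..j})"
  have V: "arnoldi_v M r i \<in> V" if "i \<in> {1..j}" for i
    using that by (simp add: V_def span_base)
  have "V \<subseteq> krylov M r j"
    unfolding V_def using arnoldi_v_in_krylov[of M r] krylov_mono[of _ j M r]
    by (intro span_minimal subspace_krylov) fastforce
  \<comment> \<open>For \<open>r = 0\<close> both sides are zero.\<close>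
  have "r = norm r *\<^sub>R arnoldi_v M r 1"
    by (cases "r = 0") simp_all
  then have "r \<in> V"
    using V[of 1] assms(1) unfolding V_def by (metis atLeastAtMost_iff order_refl span_mul)
  have "M *v arnoldi_v M r i \<in> V" if i: "i \<in> {1..j}" for i
  proof -
    have "arnoldi_h M r (i + 1) i *\<^sub>R arnoldi_v M r (i + 1) \<in> V"
    proof (cases "i = j")
      case True
      then show ?thesis
        using h by (simp add: V_def span_0)
    next
      case False
      then have "arnoldi_v M r (i + 1) \<in> V"
        using i by (intro V) auto
      then show ?thesis
        unfolding V_def by (rule span_mul)
    qed
    moreover have "(\<Sum>l = 1..i. arnoldi_h M r l i *\<^sub>R arnoldi_v M r l) \<in> V"
      using V i unfolding V_def by (intro span_sum span_mul) auto
    ultimately show ?thesis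
      using i unfolding V_def by (subst matrix_vector_mult_arnoldi_v) (auto intro: span_add)
  qed
  then have "span ((*v) M ` arnoldi_v M r ` {1..j}) \<subseteq> V"
    by (intro span_minimal) (auto simp: V_def)
  then have "(*v) M ` V \<subseteq> V"
    unfolding V_def by (simp add: linear_span_image)
  then have inv: "M *v u \<in> V" if "u \<in> V" for u
    using that by blast
  have "krylov M r j \<subseteq> V"
    using \<open>r \<in> V\<close> inv by (intro krylov_least) (simp_all add: V_def)
  then show ?thesis
    using u inv \<open>V \<subseteq> krylov M r j\<close> by blast
qed

section \<open>GMRES for symmetric matrices\<close>

lemma gmres_iterate_exists: "\<exists>z. gmres_iterate M b z0 k z"
  using exists_orthogonal_residual[OF subspace_krylov]
    is_arg_min_residual_if_orthogonal[OF subspace_krylov]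
  unfolding gmres_iterate_def Let_def by metis

lemma gmres_iterate_least_squares_if_breakdown:
  assumes "transpose M = M" "1 \<le> j" "gmres_breakdown M b z0 j" "gmres_iterate M b z0 j z"
  shows "least_squares_solution M b z"
proof -
  define r where "r = b - M *v z0"
  obtain w where z: "z = z0 + w"
    and "is_arg_min (\<lambda>w. norm (r - M *v w)) (\<lambda>w. w \<in> krylov M r j) w"
    using assms(4) unfolding gmres_iterate_def Let_def r_def by blast
  then have "M *v (r - M *v w) = 0"
    using assms(1-3) by (intro arg_min_invariant_subspace[of M "krylov M r j"])
      (simp_all add: subspace_krylov initial_in_krylov krylov_invariant_if_breakdown
        gmres_breakdown_def r_def)
  then show ?thesis
    using assms(1)
    by (simp add: least_squares_solution_iff z r_def matrix_vector_right_distrib diff_diff_eq)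
qed

lemma some_gmres_iterate_least_squares:
  assumes "transpose M = M"
  shows "\<exists>k z. gmres_iterate M b z0 k z \<and> least_squares_solution M b z"
proof -
  define r where "r = b - M *v z0"
  define K where "K = (\<Union>k. krylov M r k)"
  have K: "subspace K"
    unfolding K_def by (rule subspace_Union_krylov)
  have "r \<in> K"
    unfolding K_def using initial_in_krylov by blast
  have inv: "M *v u \<in> K" if "u \<in> K" for u
    using that matrix_vector_mult_in_krylov unfolding K_def by blast
  obtain w where "w \<in> K" and orth: "\<And>u. u \<in> K \<Longrightarrow> (r - M *v w) \<bullet> (M *v u) = 0"
    using exists_orthogonal_residual[OF K, of r M] by metis
  then obtain k where k: "w \<in> krylov M r k"
    unfolding K_def by blast
  \<comment> \<open>The normal equations over \<open>K\<close> restrict to the Krylov space that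
    contains \<open>w\<close>, so a minimizer over \<open>K\<close> is an iterate.\<close>
  have "is_arg_min (\<lambda>w. norm (r - M *v w)) (\<lambda>w. w \<in> krylov M r k) w"
    using k orth by (intro is_arg_min_residual_if_orthogonal subspace_krylov) (auto simp: K_def)
  then have "gmres_iterate M b z0 k (z0 + w)"
    unfolding gmres_iterate_def Let_def r_def by blast
  moreover have "M *v (r - M *v w) = 0"
    using assms K \<open>r \<in> K\<close> inv is_arg_min_residual_if_orthogonal[OF K \<open>w \<in> K\<close> orth]
    by (rule arg_min_invariant_subspace)
  then have "least_squares_solution M b (z0 + w)"
    using assms
    by (simp add: least_squares_solution_iff r_def matrix_vector_right_distrib diff_diff_eq)
  ultimately show ?thesis
    by blast
qed

theorem gmres_symmetric_without_breakdown:
  assumes "transpose M = M"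
  shows "\<exists>z. gmres_determines_without_breakdown M b z0 z"
proof -
  let ?P = "\<lambda>k. \<exists>z. gmres_iterate M b z0 k z \<and> least_squares_solution M b z"
  \<comment> \<open>At the first index with a least squares iterate, an earlier breakdown
    \<open>j\<close> would make \<open>?P j\<close> true, against minimality. Here
    \<open>k = 0\<close> means that \<open>z0\<close> is already a solution.\<close>
  define k where "k = (LEAST k. ?P k)"
  have "?P k"
    unfolding k_def by (rule LeastI_ex) (rule some_gmres_iterate_least_squares[OF assms])
  moreover have "\<not> gmres_breakdown M b z0 j" if "1 \<le> j" "j < k" for j
    using gmres_iterate_least_squares_if_breakdown[OF assms \<open>1 \<le> j\<close>] gmres_iterate_exists
      not_less_Least[of j ?P] \<open>j < k\<close> unfolding k_def by blast
  ultimately show ?thesis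
    unfolding gmres_determines_without_breakdown_def by blast
qed

theorem mainTheorem1:
  fixes A C :: "real^'n^'n" and b z0 :: "real^'n"
  assumes "sym_pos_def C"
  shows "(\<exists>z. gmres_determines_without_breakdown (A ** C ** transpose A) b z0 z) \<and>
         (\<forall>z. gmres_determines_without_breakdown (A ** C ** transpose A) b z0 z \<longrightarrow>
              least_squares_solution A b (C *v (transpose A *v z)))"
proof (intro conjI allI impI)
  define M where "M = A ** C ** transpose A"
  have C: "transpose C = C" and pos: "\<And>x. x \<noteq> 0 \<Longrightarrow> 0 < x \<bullet> (C *v x)"
    using assms by (auto simp: sym_pos_def_def)
  have sym: "transpose M = M"
    using C by (simp add: M_def matrix_transpose_mul matrix_mul_assoc)
  show "\<exists>z. gmres_determines_without_breakdown (A ** C ** transpose A) b z0 z"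
    using gmres_symmetric_without_breakdown[OF sym] by (simp add: M_def)
  have M: "M *v x = A *v (C *v (transpose A *v x))" for x
    by (simp add: M_def matrix_vector_mul_assoc matrix_mul_assoc del: transpose_matrix_vector)
  fix z
  assume "gmres_determines_without_breakdown (A ** C ** transpose A) b z0 z"
  then have "least_squares_solution M b z"
    by (auto simp: gmres_determines_without_breakdown_def M_def)
  then have Ms: "M *v (b - M *v z) = 0"
    using sym by (simp add: least_squares_solution_iff)
  define s where "s = b - M *v z"
  have "(transpose A *v s) \<bullet> (C *v (transpose A *v s)) = s \<bullet> (M *v s)"
    unfolding M by (rule inner_matrix_vector_transpose[symmetric])
  then have "transpose A *v s = 0"
    using pos[of "transpose A *v s"] Ms by (auto simp: s_def)
  \<comment> \<open>As \<open>M *v z\<close> is \<open>A\<close> applied to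
    \<open>C *v (transpose A *v z)\<close>, \<open>s\<close> is also the residual of the original
    system.\<close>
  then show "least_squares_solution A b (C *v (transpose A *v z))"
    by (simp add: least_squares_solution_iff s_def M del: transpose_matrix_vector)
qed

end
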